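(* Suppose that $\alpha_{i_0}<0<\alpha_{i_0+1}$, and consider the following eight cases for the parameter $a$: (1) $f_a^{(m_{i_0})}(\alpha_{i_0})>0$, $f_a^{(m_{i_0+1})}(\alpha_{i_0+1})>0$, $m_{i_0}$ is even; (2) $f_a^{(m_{i_0})}(\alpha_{i_0})>0$, $f_a^{(m_{i_0+1})}(\alpha_{i_0+1})<0$, $m_{i_0}$ is even; (3) $f_a^{(m_{i_0})}(\alpha_{i_0})>0$, $f_a^{(m_{i_0+1})}(\alpha_{i_0+1})>0$, $m_{i_0}$ is odd; (4) $f_a^{(m_{i_0})}(\alpha_{i_0})>0$, $f_a^{(m_{i_0+1})}(\alpha_{i_0+1})<0$, $m_{i_0}$ is odd; (5) $f_a^{(m_{i_0})}(\alpha_{i_0})<0$, $f_a^{(m_{i_0+1})}(\alpha_{i_0+1})>0$, $m_{i_0}$ is odd; (6) $f_a^{(m_{i_0})}(\alpha_{i_0})<0$, $f_a^{(m_{i_0+1})}(\alpha_{i_0+1})<0$, $m_{i_0}$ is odd; (7) $f_a^{(m_{i_0})}(\alpha_{i_0})<0$, $f_a^{(m_{i_0+1})}(\alpha_{i_0+1})>0$, $m_{i_0}$ is even; (8) $f_a^{(m_{i_0})}(\alpha_{i_0})<0$, $f_a^{(m_{i_0+1})}(\alpha_{i_0+1})<0$, $m_{i_0}$ is even. Then there exists $N>0$ such that for every $a\in\mathbb{R}$ with $|a|>N$ the following holds. If $a$ is in Case (2) or Case (6), there exists a hyperbolic invariant set $\Lambda_a$ for $f_a$ such that $f_a:\Lambda_a\to\Lambda_a$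 is topologically conjugate to $\sigma_A:\Sigma_A\to\Sigma_A$, where $$A=\begin{pmatrix}0&0&1\\0&0&1\\1&1&1\end{pmatrix}.$$ In each of the other cases, there exists a hyperbolic invariant set $\Lambda_a$ for $f_a$ such that $f_a:\Lambda_a\to\Lambda_a$ is topologically conjugate to $\sigma:\Sigma_2\to\Sigma_2$.
   Context: Let $g(x)=x^n+a_{n-1}x^{n-1}+\cdots+a_0$ be a real-coefficient polynomial whose distinct real zeros are $\alpha_1<\cdots<\alpha_r$ with $r\ge 2$, where $\alpha_i$ has multiplicity $m_i\ge 1$. Fix an index $i_0$ with $1\le i_0<r$. For a real parameter $a$ let $f_a(x)=a g(x)$; $f_a^{(m)}$ denotes the $m$-th derivative of $f_a$. A set $\Lambda$ is invariant for $f$ if $f(\Lambda)=\Lambda$. For a $C^1$ map $f:\mathbb{R}\to\mathbb{R}$, a compact invariant set $\Lambda$ is a hyperbolic (invariant) set for $f$ if there are constants $C>0$ and $\lambda>1$ such that $|(f^n)'(x)|\ge C\lambda^n$ for all $x\in\Lambda$ and all $n\ge1$, where $f^n$ is the $n$-fold iterate. For $m\ge2$, $\Sigma_m=\{(s_0,s_1,s_2,\dots): s_i\in\{1,\dots,m\}\}$ is the one-sided sequence space on $m$ symbols with the metric $d(s,t)=\sum_{i\ge0}\delta(s_i,t_i)/2^i$ ($\delta(s_i,t_i)=1$ if $s_i\ne t_i$ and $0$ otherwise), and $\sigma(s_0,s_1,s_2,\dots)=(s_1,s_2,\dots)$ is the shift map. For an $m\times m$ matrix $A=(a_{ij})$ with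 entries in $\{0,1\}$ and no zero row or column, $\Sigma_A=\{(s_0,s_1,\dots)\in\Sigma_m: a_{s_is_{i+1}}=1\ \text{for all}\ i\ge0\}$ and $\sigma_A=\sigma|_{\Sigma_A}:\Sigma_A\to\Sigma_A$ is the subshift of finite type for $A$. *)

theory Defs
  imports "HOL-Analysis.Analysis" "HOL-Computational_Algebra.Polynomial"
begin

definition invariant_set :: "('a \<Rightarrow> 'a) \<Rightarrow> 'a set \<Rightarrow> bool" where
  "invariant_set f L \<longleftrightarrow> f ` L = L"

definition hyperbolic_invariant_set :: "(real \<Rightarrow> real) \<Rightarrow> real set \<Rightarrow> bool" where
  "hyperbolic_invariant_set f L \<longleftrightarrow>
     f C1_differentiable_on UNIV \<and> compact L \<and> invariant_set f L \<and>
     (\<exists>C>0. \<exists>K>1. \<forall>x\<in>L. \<forall>n\<ge>1. \<bar>deriv (f ^^ n) x\<bar> \<ge> C * K ^ n)"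

definition topologically_conjugate ::
    "'a topology \<Rightarrow> ('a \<Rightarrow> 'a) \<Rightarrow> 'b topology \<Rightarrow> ('b \<Rightarrow> 'b) \<Rightarrow> bool" where
  "topologically_conjugate X f Y g \<longleftrightarrow>
     f \<in> topspace X \<rightarrow> topspace X \<and> g \<in> topspace Y \<rightarrow> topspace Y \<and>
     (\<exists>h. homeomorphic_map X Y h \<and> (\<forall>x\<in>topspace X. h (f x) = g (h x)))"

definition seq_space :: "nat \<Rightarrow> (nat \<Rightarrow> nat) set" where
  "seq_space m = {s. \<forall>i. s i \<in> {1..m}}"

definition seq_dist :: "(nat \<Rightarrow> nat) \<Rightarrow> (nat \<Rightarrow> nat) \<Rightarrow> real" where
  "seq_dist s t = (\<Sum>i. (if s i \<noteq> t i then 1 else 0) / 2 ^ i)"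

definition shift :: "(nat \<Rightarrow> nat) \<Rightarrow> (nat \<Rightarrow> nat)" where
  "shift s = (\<lambda>i. s (Suc i))"

(* An m x m matrix is a function of two indices, read only on {1..m} x {1..m}. *)

definition transition_matrix :: "nat \<Rightarrow> (nat \<Rightarrow> nat \<Rightarrow> nat) \<Rightarrow> bool" where
  "transition_matrix m A \<longleftrightarrow>
     (\<forall>i\<in>{1..m}. \<forall>j\<in>{1..m}. A i j \<in> {0, 1}) \<and>
     (\<forall>i\<in>{1..m}. \<exists>j\<in>{1..m}. A i j \<noteq> 0) \<and>
     (\<forall>j\<in>{1..m}. \<exists>i\<in>{1..m}. A i j \<noteq> 0)"

definition subshift_space :: "nat \<Rightarrow> (nat \<Rightarrow> nat \<Rightarrow> nat) \<Rightarrow> (nat \<Rightarrow> nat) set" where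
  "subshift_space m A = {s \<in> seq_space m. \<forall>i. A (s i) (s (Suc i)) = 1}"

definition matrix_A :: "nat \<Rightarrow> nat \<Rightarrow> nat" where
  "matrix_A i j = [[0, 0, 1],
                   [0, 0, 1],
                   [1, 1, 1]] ! (i - 1) ! (j - 1)"

lemma atLeastAtMost_1_3: "{1..3::nat} = {1, 2, 3}"
  by auto

lemma transition_matrix_A: "transition_matrix 3 matrix_A"
  unfolding transition_matrix_def atLeastAtMost_1_3 by (simp add: matrix_A_def)

lemma summable_seq_dist:
  "summable (\<lambda>i. (if s i \<noteq> t i then 1 else 0) / 2 ^ i :: real)"
proof (rule summable_comparison_test')
  show "summable (\<lambda>i. (1/2) ^ i :: real)"
    by (simp add: summable_geometric)
qed (simp add: power_one_over)

lemma Metric_space_seq_dist: "Metric_space S seq_dist"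
proof
  fix s t u :: "nat \<Rightarrow> nat"
  show "0 \<le> seq_dist s t"
    unfolding seq_dist_def by (rule suminf_nonneg[OF summable_seq_dist]) simp
  show "seq_dist s t = seq_dist t s"
    unfolding seq_dist_def by (simp add: eq_commute)
  show "seq_dist s t = 0 \<longleftrightarrow> s = t"
    unfolding seq_dist_def by (subst suminf_eq_zero_iff[OF summable_seq_dist]) (auto simp: fun_eq_iff)
  show "seq_dist s u \<le> seq_dist s t + seq_dist t u"
    unfolding seq_dist_def suminf_add[OF summable_seq_dist summable_seq_dist]
    by (rule suminf_le[OF _ summable_seq_dist summable_add[OF summable_seq_dist summable_seq_dist]])
       (auto simp: add_divide_distrib[symmetric] divide_right_mono)
qed

definition seq_topology :: "(nat \<Rightarrow> nat) set \<Rightarrow> (nat \<Rightarrow> nat) topology" where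
  "seq_topology S = Metric_space.mtopology S seq_dist"

lemma topspace_seq_topology: "topspace (seq_topology S) = S"
  unfolding seq_topology_def by (rule Metric_space.topspace_mtopology[OF Metric_space_seq_dist])

definition scaled_poly :: "real poly \<Rightarrow> real \<Rightarrow> real \<Rightarrow> real" where
  "scaled_poly g a = (\<lambda>x. a * poly g x)"

definition parameter_case ::
    "nat \<Rightarrow> real poly \<Rightarrow> (nat \<Rightarrow> real) \<Rightarrow> (nat \<Rightarrow> nat) \<Rightarrow> nat \<Rightarrow> real \<Rightarrow> bool" where
  "parameter_case k g \<alpha> m i a \<longleftrightarrow>
     (let p = (deriv ^^ m i) (scaled_poly g a) (\<alpha> i);
          q = (deriv ^^ m (i + 1)) (scaled_poly g a) (\<alpha> (i + 1))
      in (k = 1 \<and> p > 0 \<and> q > 0 \<and> even (m i)) \<or>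
         (k = 2 \<and> p > 0 \<and> q < 0 \<and> even (m i)) \<or>
         (k = 3 \<and> p > 0 \<and> q > 0 \<and> odd (m i)) \<or>
         (k = 4 \<and> p > 0 \<and> q < 0 \<and> odd (m i)) \<or>
         (k = 5 \<and> p < 0 \<and> q > 0 \<and> odd (m i)) \<or>
         (k = 6 \<and> p < 0 \<and> q < 0 \<and> odd (m i)) \<or>
         (k = 7 \<and> p < 0 \<and> q > 0 \<and> even (m i)) \<or>
         (k = 8 \<and> p < 0 \<and> q < 0 \<and> even (m i)))"

end

theory Submission
  imports Defs
begin

text \<open>
  Write \<open>f = a * g\<close> and let \<open>u < 0 < v\<close> be the two consecutive zeros. Near a zero \<open>z\<close> of multiplicity \<open>m\<close>
  the quotient \<open>g' / g\<close> behaves like \<open>m / (x - z)\<close>. Fix \<open>0 < c < d\<close>. If \<open>|a|\<close> is large, a point \<open>x\<close> near \<open>z\<close>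
  with \<open>|f x|\<close> in \<open>[c, d]\<close> has \<open>|g x| \<le> d / |a|\<close> and so lies very close to \<open>z\<close>; therefore
  \<open>|f' x| = |f x| * |g' x / g x|\<close> is large there, whatever the multiplicity is. A zero at which \<open>f'\<close>
  vanishes does no harm because its value \<open>0\<close> is outside the region in which orbits are kept.

  Choose \<open>c < |u|, v < d\<close> and call \<open>[c, d]\<close> and \<open>[-d, -c]\<close> the positive and the negative band; a small
  neighbourhood of \<open>v\<close> lies in the first and one of \<open>u\<close> in the second. Each of the four one-sided
  neighbourhoods of \<open>u\<close> and \<open>v\<close> contains exactly one interval, a half branch, on which \<open>|f|\<close> takes
  values in \<open>[c, d]\<close>. By \<open>eventually_expanding_branch\<close>, \<open>f\<close> maps it expandingly onto the band of the sign
  that \<open>f\<close> has on this side of the zero. So the dynamics is a Markov graph which depends only on four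
  signs. Two of them, right of \<open>u\<close> and left of \<open>v\<close>, agree since \<open>g\<close> has no zero in between
  (\<open>leading_sign_adjacent_zeros\<close>), and all of them can be read off from the derivatives of order
  \<open>m\<close> at the zeros and the parity of the multiplicity (\<open>near_root\<close>,
  \<open>sgn_higher_deriv_at_zero\<close>). Three patterns occur.
  \<^item> Both half branches at one zero cover the band of that zero: a full 2-shift
    (\<open>horseshoe_same_zero\<close>; cases 1, 3, 7, 8).
  \<^item> \<open>f\<close> changes sign at both zeros, so the pair of half branches at each zero covers both bands: a full
    2-shift whose symbols are the two zeros (\<open>horseshoe_two_crossings\<close>; cases 4, 5).
  \<^item> \<open>f\<close> keeps its sign at one zero and changes it at the other. The two half branches at the first
    zero are the symbols 1 and 2 and both cover only the neighbourhood of the second zero, which is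
    symbol 3 and covers everything (\<open>horseshoe_fold_and_crossing\<close>; cases 2, 6).

  Passing from such a covering pattern to a hyperbolic set and a conjugacy is the classical coding by
  itineraries, done once in the locale \<open>expanding_markov\<close>.
\<close>

section \<open>Coding of expanding Markov families\<close>

lemma seq_dist_agree:
  assumes "\<And>i. i < n \<Longrightarrow> s i = t i"
  shows "seq_dist s t \<le> 2 * (1/2) ^ n"
proof -
  have "seq_dist s t = (\<Sum>i. (if s (i+n) \<noteq> t (i+n) then 1 else 0) / 2 ^ (i+n))
      + (\<Sum>i<n. (if s i \<noteq> t i then 1 else 0) / 2 ^ i)"
    unfolding seq_dist_def by (rule suminf_split_initial_segment[OF summable_seq_dist])
  also have "(\<Sum>i<n. (if s i \<noteq> t i then 1 else 0) / 2 ^ i :: real) = 0"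
    using assms by (intro sum.neutral) auto
  also have "(\<Sum>i. (if s (i+n) \<noteq> t (i+n) then 1 else 0) / 2 ^ (i+n) :: real)
      \<le> (\<Sum>i. (1/2) ^ n * (1/2) ^ i)"
    by (intro suminf_le summable_ignore_initial_segment[OF summable_seq_dist] summable_mult
        summable_geometric) (auto simp: power_add power_one_over field_simps)
  also have "\<dots> = 2 * (1/2) ^ n"
    by (subst suminf_mult) (auto simp: suminf_geometric summable_geometric)
  finally show ?thesis by simp
qed

lemma DERIV_funpow:
  fixes f f' :: "real \<Rightarrow> real"
  assumes "\<And>x. (f has_real_derivative f' x) (at x)"
  shows "((f ^^ n) has_real_derivative (\<Prod>k<n. f' ((f ^^ k) x))) (at x)"
proof (induction n)
  case (Suc n)
  have "((\<lambda>x. f ((f ^^ n) x)) has_real_derivative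
      f' ((f ^^ n) x) * (\<Prod>k<n. f' ((f ^^ k) x))) (at x)"
    by (rule DERIV_chain2[OF assms Suc])
  then show ?case by (simp add: o_def mult.commute)
qed (simp add: id_def)

text \<open>
  The pieces need not be intervals, and expansion is asked only between points of one piece whose images
  lie in one piece. This allows a single symbol to stand for points on both sides of a zero at which
  the derivative of the map may vanish.
\<close>

locale expanding_markov =
  fixes f f' :: "real \<Rightarrow> real" and n :: nat and A :: "nat \<Rightarrow> nat \<Rightarrow> nat"
    and J :: "nat \<Rightarrow> real set" and K :: real
  assumes has_deriv: "\<And>x. (f has_real_derivative f' x) (at x)"
    and cont_deriv: "continuous_on UNIV f'"
    and matrix: "transition_matrix n A"
    and compact_J: "\<And>i. i \<in> {1..n} \<Longrightarrow> compact (J i)"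
    and nonempty_J: "\<And>i. i \<in> {1..n} \<Longrightarrow> J i \<noteq> {}"
    and disjoint_J: "disjoint_family_on J {1..n}"
    and K: "K > 1"
    and cover: "\<And>i j. \<lbrakk>i \<in> {1..n}; j \<in> {1..n}; A i j = 1\<rbrakk> \<Longrightarrow> J j \<subseteq> f ` J i"
    and expand: "\<And>i j x y. \<lbrakk>i \<in> {1..n}; j \<in> {1..n}; A i j = 1; x \<in> J i; y \<in> J i; f x \<in> J j; f y \<in> J j\<rbrakk>
      \<Longrightarrow> K * \<bar>x - y\<bar> \<le> \<bar>f x - f y\<bar>"
    and deriv_ge: "\<And>i x. \<lbrakk>i \<in> {1..n}; x \<in> J i\<rbrakk> \<Longrightarrow> K \<le> \<bar>f' x\<bar>"
begin

definition realizes :: "real \<Rightarrow> (nat \<Rightarrow> nat) \<Rightarrow> bool" where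
  "realizes x s \<longleftrightarrow> s \<in> subshift_space n A \<and> (\<forall>k. (f ^^ k) x \<in> J (s k))"

definition \<Lambda> :: "real set" where
  "\<Lambda> = {x. \<exists>s. realizes x s}"

definition itinerary :: "real \<Rightarrow> nat \<Rightarrow> nat" where
  "itinerary x = (\<lambda>k. THE i. i \<in> {1..n} \<and> (f ^^ k) x \<in> J i)"

lemma symbol_unique:
  assumes "i \<in> {1..n}" "j \<in> {1..n}" "x \<in> J i" "x \<in> J j"
  shows "i = j"
  using disjoint_J assms unfolding disjoint_family_on_def by blast

lemma symbolD:
  assumes "realizes x s"
  shows "s k \<in> {1..n}" "A (s k) (s (Suc k)) = 1" "(f ^^ k) x \<in> J (s k)"
  using assms unfolding realizes_def subshift_space_def seq_space_def by auto

lemma itinerary_eq: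
  assumes "realizes x s"
  shows "itinerary x = s"
proof
  fix k
  show "itinerary x k = s k"
    unfolding itinerary_def
    by (rule the_equality) (use symbolD[OF assms, of k] symbol_unique in blast)+
qed

lemma realizes_itinerary: "x \<in> \<Lambda> \<Longrightarrow> realizes x (itinerary x)"
  unfolding \<Lambda>_def using itinerary_eq by auto

lemma realizes_shift:
  assumes "realizes x s" shows "realizes (f x) (shift s)"
proof -
  have "(f ^^ k) (f x) \<in> J (s (Suc k))" for k
    using symbolD(3)[OF assms, of "Suc k"] by (simp add: funpow_swap1)
  then show ?thesis
    using assms unfolding realizes_def subshift_space_def seq_space_def shift_def by simp
qed

lemma continuous_funpow: "continuous_on S (f ^^ k)"
  by (rule continuous_at_imp_continuous_on)
     (use DERIV_isCont[OF DERIV_funpow[OF has_deriv]] in blast)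

lemma continuous_f: "continuous_on S f"
  using continuous_funpow[of S 1] by simp

text \<open>
  Since the pieces are disjoint, an admissible itinerary can be checked on pairs of consecutive points.
  This exhibits \<open>\<Lambda>\<close> as an intersection of preimages of one closed set.
\<close>

lemma \<Lambda>_eq:
  "\<Lambda> = (\<Inter>k. (f ^^ k) -` (\<Union>i\<in>{1..n}. \<Union>j\<in>{j\<in>{1..n}. A i j = 1}. J i \<inter> f -` J j))"
  (is "_ = ?R")
proof
  show "\<Lambda> \<subseteq> ?R"
  proof
    fix x assume "x \<in> \<Lambda>"
    then obtain s where s: "realizes x s" unfolding \<Lambda>_def by blast
    show "x \<in> ?R"
    proof (intro INT_I vimageI2)
      fix k
      have "(f ^^ k) x \<in> J (s k) \<inter> f -` J (s (Suc k))"
        using symbolD(3)[OF s, of k] symbolD(3)[OF s, of "Suc k"] by simp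
      then show "(f ^^ k) x \<in> (\<Union>i\<in>{1..n}. \<Union>j\<in>{j\<in>{1..n}. A i j = 1}. J i \<inter> f -` J j)"
        using symbolD(1,2)[OF s, of k] symbolD(1)[OF s, of "Suc k"] by blast
    qed
  qed
next
  show "?R \<subseteq> \<Lambda>"
  proof
    fix x assume "x \<in> ?R"
    then have "\<forall>k. \<exists>i j. i \<in> {1..n} \<and> j \<in> {1..n} \<and> A i j = 1 \<and> (f ^^ k) x \<in> J i \<and> f ((f ^^ k) x) \<in> J j"
      by blast
    then obtain s t where st: "\<And>k. s k \<in> {1..n}" "\<And>k. t k \<in> {1..n}" "\<And>k. A (s k) (t k) = 1"
      "\<And>k. (f ^^ k) x \<in> J (s k)" "\<And>k. f ((f ^^ k) x) \<in> J (t k)"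
      by metis
    have "t k = s (Suc k)" for k
      using symbol_unique[OF st(2) st(1) st(5)[of k]] st(4)[of "Suc k"] by simp
    then have "A (s k) (s (Suc k)) = 1" for k using st(3)[of k] by simp
    then have "realizes x s"
      unfolding realizes_def subshift_space_def seq_space_def using st(1,4) by blast
    then show "x \<in> \<Lambda>" unfolding \<Lambda>_def by blast
  qed
qed

lemma bounded_pieces: "bounded (\<Union>i\<in>{1..n}. J i)"
  by (intro bounded_UN ballI compact_imp_bounded compact_J) auto

lemma compact_\<Lambda>: "compact \<Lambda>"
proof -
  have "closed (\<Union>i\<in>{1..n}. \<Union>j\<in>{j\<in>{1..n}. A i j = 1}. J i \<inter> f -` J j)"
    by (intro closed_UN closed_Int closed_vimage finite_Collect_conjI disjI1 compact_imp_closed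
        continuous_f compact_J ballI) auto
  then have "closed \<Lambda>"
    unfolding \<Lambda>_eq by (intro closed_INT ballI closed_vimage continuous_funpow) auto
  moreover have "bounded (\<Union>i\<in>{1..n}. J i)" by (rule bounded_pieces)
  moreover have "\<Lambda> \<subseteq> (\<Union>i\<in>{1..n}. J i)"
    unfolding \<Lambda>_def using symbolD(1,3)[of _ _ 0] by force
  ultimately show ?thesis
    using bounded_subset compact_eq_bounded_closed by blast
qed

lemma shift_in_subshift: "s \<in> subshift_space n A \<Longrightarrow> shift s \<in> subshift_space n A"
  unfolding subshift_space_def seq_space_def shift_def by auto

lemma finite_word_realized:
  assumes "s \<in> subshift_space n A"
  shows "\<exists>x. \<forall>k\<le>N. (f ^^ k) x \<in> J (s k)"
  using assms
  \<comment> \<open>A point that follows the shifted word is pulled back through \<open>J (s 0)\<close> by the covering relation.\<close>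
proof (induction N arbitrary: s)
  case 0
  then have "J (s 0) \<noteq> {}"
    by (intro nonempty_J) (auto simp: subshift_space_def seq_space_def)
  then show ?case by auto
next
  case (Suc N)
  from Suc.IH[OF shift_in_subshift[OF Suc.prems]]
  obtain y where y: "\<And>k. k \<le> N \<Longrightarrow> (f ^^ k) y \<in> J (s (Suc k))"
    unfolding shift_def by auto
  have "J (s (Suc 0)) \<subseteq> f ` J (s 0)"
    by (rule cover) (use Suc.prems in \<open>auto simp: subshift_space_def seq_space_def\<close>)
  with y[of 0] obtain x where x: "x \<in> J (s 0)" "f x = y" by auto
  have "(f ^^ k) x \<in> J (s k)" if "k \<le> Suc N" for k
  proof (cases k)
    case (Suc k')
    then show ?thesis
      using y[of k'] x(2) that by (simp add: funpow_Suc_right del: funpow.simps)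
  qed (use x in simp)
  then show ?case by blast
qed

text \<open>By compactness the nested sets of points that follow ever longer initial words have a common point.\<close>

lemma word_realized:
  assumes s: "s \<in> subshift_space n A"
  shows "\<exists>x. realizes x s"
proof -
  define S where "S N = (\<Inter>k\<in>{..N}. (f ^^ k) -` J (s k))" for N
  have sn: "s k \<in> {1..n}" for k
    using s unfolding subshift_space_def seq_space_def by auto
  have closed: "closed (S N)" for N
    unfolding S_def
    by (intro closed_INT ballI closed_vimage continuous_funpow compact_imp_closed compact_J sn)
  have sub: "S N \<subseteq> J (s 0)" for N
    unfolding S_def by force
  have "(\<Inter>N. S N) \<noteq> {}"
  proof (rule compact_nest)
    show "compact (S N)" for N
      using compact_Int_closed[OF compact_J[OF sn] closed] sub[of N] by (metis Int_absorb1)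
    show "S N \<noteq> {}" for N
      using finite_word_realized[OF s, of N] unfolding S_def by auto
    show "S N \<subseteq> S M" if "M \<le> N" for M N
      unfolding S_def using that by (intro INT_anti_mono) auto
  qed
  then obtain x where "\<And>N. x \<in> S N" by blast
  then have "realizes x s"
    unfolding realizes_def S_def using s by auto
  then show ?thesis ..
qed

text \<open>
  Distances of two orbits with the same itinerary grow like \<open>K ^ k\<close>, which the boundedness of the pieces
  forbids unless the orbits coincide.
\<close>

lemma itinerary_separates:
  assumes x: "realizes x s" and y: "realizes y s"
  shows "x = y"
proof (rule ccontr)
  assume "x \<noteq> y"
  have step: "K ^ k * \<bar>x - y\<bar> \<le> \<bar>(f ^^ k) x - (f ^^ k) y\<bar>" for k
  proof (induction k)
    case (Suc k)
    have "K ^ Suc k * \<bar>x - y\<bar> \<le> K * \<bar>(f ^^ k) x - (f ^^ k) y\<bar>"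
      using Suc K by simp
    also have "\<dots> \<le> \<bar>f ((f ^^ k) x) - f ((f ^^ k) y)\<bar>"
      using expand[OF symbolD(1)[OF x, of k] symbolD(1)[OF x, of "Suc k"] symbolD(2)[OF x]]
        symbolD(3)[OF x] symbolD(3)[OF y]
      using symbolD(3)[OF x, of "Suc k"] symbolD(3)[OF y, of "Suc k"] by simp
    finally show ?case by simp
  qed simp
  obtain B where B: "\<And>i z. \<lbrakk>i \<in> {1..n}; z \<in> J i\<rbrakk> \<Longrightarrow> \<bar>z\<bar> \<le> B"
    using bounded_pieces unfolding bounded_iff by force
  obtain k where k: "2 * B / \<bar>x - y\<bar> < K ^ k"
    using real_arch_pow[OF K] by blast
  have "\<bar>(f ^^ k) x - (f ^^ k) y\<bar> \<le> 2 * B"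
    using B[OF symbolD(1,3)[OF x, of k]] B[OF symbolD(1)[OF y] symbolD(3)[OF y], of k] by linarith
  with step[of k] k \<open>x \<noteq> y\<close> show False
    by (simp add: field_simps)
qed

text \<open>
  A point of \<open>\<Lambda>\<close> gets a preimage in \<open>\<Lambda>\<close> by prefixing its itinerary with an admissible symbol, which
  exists because no column of the transition matrix vanishes.
\<close>

lemma f_image_\<Lambda>: "f ` \<Lambda> = \<Lambda>"
proof
  show "f ` \<Lambda> \<subseteq> \<Lambda>"
    unfolding \<Lambda>_def using realizes_shift by blast
  show "\<Lambda> \<subseteq> f ` \<Lambda>"
  proof
    fix y assume "y \<in> \<Lambda>"
    then obtain s where s: "realizes y s" unfolding \<Lambda>_def by blast
    have s0: "s 0 \<in> {1..n}" by (rule symbolD[OF s])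
    obtain i where i: "i \<in> {1..n}" "A i (s 0) \<noteq> 0"
      using matrix s0 unfolding transition_matrix_def by blast
    moreover have "A i (s 0) \<in> {0, 1}"
      using matrix s0 i(1) unfolding transition_matrix_def by blast
    ultimately have i: "i \<in> {1..n}" "A i (s 0) = 1" by auto
    define t where "t = case_nat i s"
    have "t \<in> subshift_space n A"
      unfolding t_def subshift_space_def seq_space_def
      using i symbolD(1,2)[OF s] by (auto split: nat.splits)
    then obtain x where x: "realizes x t" using word_realized by blast
    have "shift t = s" unfolding shift_def t_def by simp
    then have "f x = y"
      using itinerary_separates[OF _ s] realizes_shift[OF x] by simp
    then show "y \<in> f ` \<Lambda>" using x unfolding \<Lambda>_def by blast
  qed
qed

lemma hyperbolic: "hyperbolic_invariant_set f \<Lambda>"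
  unfolding hyperbolic_invariant_set_def invariant_set_def
proof (intro conjI compact_\<Lambda> f_image_\<Lambda>)
  show "f C1_differentiable_on UNIV"
    unfolding C1_differentiable_on_def
    using has_deriv cont_deriv has_real_derivative_iff_has_vector_derivative by blast
  have "K ^ N \<le> \<bar>deriv (f ^^ N) x\<bar>" if "x \<in> \<Lambda>" for x N
  proof -
    obtain s where s: "realizes x s" using \<open>x \<in> \<Lambda>\<close> unfolding \<Lambda>_def by blast
    have "K ^ N = (\<Prod>k<N. K)" by simp
    also have "\<dots> \<le> (\<Prod>k<N. \<bar>f' ((f ^^ k) x)\<bar>)"
      using K deriv_ge[OF symbolD(1,3)[OF s]] by (intro prod_mono) auto
    also have "\<dots> = \<bar>deriv (f ^^ N) x\<bar>"
      unfolding DERIV_imp_deriv[OF DERIV_funpow[OF has_deriv]] abs_prod ..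
    finally show ?thesis .
  qed
  then show "\<exists>C>0. \<exists>K>1. \<forall>x\<in>\<Lambda>. \<forall>n\<ge>1. C * K ^ n \<le> \<bar>deriv (f ^^ n) x\<bar>"
    using K by (intro exI[of _ 1] conjI exI[of _ K]) auto
qed

lemma itinerary_locally_constant:
  assumes x: "x \<in> \<Lambda>"
  shows "\<exists>U. openin (top_of_set \<Lambda>) U \<and> x \<in> U \<and> (\<forall>y\<in>U. \<forall>k<N. itinerary y k = itinerary x k)"
proof -
  define F where "F k = (\<Union>j\<in>{1..n} - {itinerary x k}. J j)" for k
  have closed: "closed (F k)" for k
    unfolding F_def
  proof (rule closed_UN)
    show "\<forall>j\<in>{1..n} - {itinerary x k}. closed (J j)"
      using compact_imp_closed[OF compact_J] by blast
  qed simp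
  define U where "U = \<Lambda> \<inter> (\<Inter>k\<in>{..<N}. (f ^^ k) -` (- F k))"
  have "open (\<Inter>k\<in>{..<N}. (f ^^ k) -` (- F k))"
    using closed continuous_funpow
    by (intro open_INT ballI open_vimage) (auto simp: open_Compl)
  then have "openin (top_of_set \<Lambda>) U"
    unfolding U_def by (rule openin_open_Int)
  moreover have "x \<in> U"
    unfolding U_def F_def using x symbolD[OF realizes_itinerary[OF x]] symbol_unique by blast
  moreover have "itinerary y k = itinerary x k" if "y \<in> U" "k < N" for y k
    using that symbolD(1,3)[OF realizes_itinerary, of y k] unfolding U_def F_def by blast
  ultimately show ?thesis by blast
qed

text \<open>
  The itinerary map is a continuous bijection from a compact space to a Hausdorff space, so continuity
  of its inverse is automatic.
\<close>

lemma conjugate: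
  "topologically_conjugate (top_of_set \<Lambda>) f (seq_topology (subshift_space n A)) shift"
proof -
  let ?S = "subshift_space n A"
  interpret M: Metric_space ?S seq_dist by (rule Metric_space_seq_dist)
  have img: "itinerary ` \<Lambda> = ?S"
  proof
    show "itinerary ` \<Lambda> \<subseteq> ?S"
      using realizes_itinerary unfolding realizes_def by blast
    show "?S \<subseteq> itinerary ` \<Lambda>"
      using word_realized itinerary_eq unfolding \<Lambda>_def by blast
  qed
  have inj: "inj_on itinerary \<Lambda>"
    by (rule inj_onI) (metis itinerary_separates realizes_itinerary)
  have "continuous_map (top_of_set \<Lambda>) M.mtopology itinerary"
    unfolding M.continuous_map_to_metric
  proof safe
    fix x and \<epsilon> :: real
    assume x: "x \<in> topspace (top_of_set \<Lambda>)" and "\<epsilon> > 0"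
    obtain N where N: "(1/2) ^ N < \<epsilon> / 2"
      using real_arch_pow_inv[of "\<epsilon> / 2" "1/2"] \<open>\<epsilon> > 0\<close> by auto
    obtain U where U: "openin (top_of_set \<Lambda>) U" "x \<in> U"
      and same: "\<And>y k. \<lbrakk>y \<in> U; k < N\<rbrakk> \<Longrightarrow> itinerary y k = itinerary x k"
      using itinerary_locally_constant[of x N] x by auto
    have "itinerary y \<in> M.mball (itinerary x) \<epsilon>" if "y \<in> U" for y
    proof -
      have "y \<in> \<Lambda>" using U(1) that openin_subset by fastforce
      moreover have "seq_dist (itinerary x) (itinerary y) < \<epsilon>"
        using seq_dist_agree[of N "itinerary x" "itinerary y"] same[OF that] N by fastforce
      ultimately show ?thesis
        using img x by (auto simp: M.in_mball)
    qed
    with U show "\<exists>U. openin (top_of_set \<Lambda>) U \<and> x \<in> U \<and>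
        (\<forall>y\<in>U. itinerary y \<in> M.mball (itinerary x) \<epsilon>)" by blast
  qed
  then have "homeomorphic_map (top_of_set \<Lambda>) M.mtopology itinerary"
    using compact_\<Lambda> inj img
    by (intro continuous_imp_homeomorphic_map M.Hausdorff_space_mtopology)
       (auto simp: compact_space_subtopology compactin_euclidean_iff)
  moreover have "itinerary (f x) = shift (itinerary x)" if "x \<in> \<Lambda>" for x
    by (rule itinerary_eq[OF realizes_shift[OF realizes_itinerary[OF that]]])
  moreover have "f \<in> \<Lambda> \<rightarrow> \<Lambda>" using f_image_\<Lambda> by blast
  ultimately show ?thesis
    unfolding topologically_conjugate_def topspace_seq_topology
    unfolding seq_topology_def
    using shift_in_subshift by auto
qed

end

section \<open>A polynomial near a real zero\<close>

lemma higher_deriv_scaled_poly: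
  "(deriv ^^ k) (scaled_poly g a) = scaled_poly ((pderiv ^^ k) g) a"
proof (induction k)
  case (Suc k)
  have "deriv (scaled_poly p a) = scaled_poly (pderiv p) a" for p
    unfolding scaled_poly_def
    by (rule ext, rule DERIV_imp_deriv) (auto intro!: derivative_eq_intros)
  then show ?case by (simp add: Suc)
qed simp

lemma higher_pderiv_at_root:
  fixes z :: real
  shows "poly ((pderiv ^^ k) ([:-z, 1:] ^ k * q)) z = fact k * poly q z"
proof (induction k arbitrary: q)
  case (Suc k)
  let ?q = "smult (of_nat (Suc k)) q + [:-z, 1:] * pderiv q"
  have "pderiv ([:-z, 1:] ^ Suc k * q) = [:-z, 1:] ^ k * ?q"
    unfolding pderiv_mult pderiv_power_Suc by (simp add: pderiv_pCons algebra_simps)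
  then have "poly ((pderiv ^^ Suc k) ([:-z, 1:] ^ Suc k * q)) z = fact k * poly ?q z"
    using Suc by (simp add: funpow_Suc_right del: funpow.simps)
  then show ?case by simp
qed simp

text \<open>
  If \<open>g = (x - z) ^ m * q\<close> with \<open>q z \<noteq> 0\<close>, this is the sign of \<open>q z\<close>, that is, the sign of \<open>g\<close> immediately
  to the right of \<open>z\<close>. The derivative of order \<open>m\<close> is the form in which the parameter cases give it.
\<close>

definition leading_sign :: "real poly \<Rightarrow> real \<Rightarrow> real" where
  "leading_sign g z = sgn (poly ((pderiv ^^ order z g) g) z)"

text \<open>
  With \<open>g = (x - z) ^ m * q\<close> one has \<open>(x - z) * g' / g = m + (x - z) * q' / q\<close>, which tends to \<open>m \<ge> 1\<close>
  and therefore exceeds \<open>1/2\<close> near \<open>z\<close>. Multiplied by \<open>2 * g\<^sup>2\<close> this is the last claim; it provides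
  both monotonicity of \<open>|g|\<close> on either side of \<open>z\<close> and a lower bound for \<open>|g'|\<close>.
\<close>

lemma near_root:
  fixes g :: "real poly"
  assumes "g \<noteq> 0" "poly g z = 0"
  shows "leading_sign g z \<noteq> 0"
    and "eventually (\<lambda>x. sgn (poly g x) = leading_sign g z * sgn (x - z) ^ order z g) (at z)"
    and "eventually (\<lambda>x. (poly g x)\<^sup>2 \<le> 2 * ((x - z) * poly (pderiv g) x * poly g x)) (at z)"
proof -
  define m where "m = order z g"
  have m: "m \<ge> 1" using assms order_root[of g z] unfolding m_def by auto
  obtain q where g: "g = [:-z, 1:] ^ m * q" and "\<not> [:-z, 1:] dvd q"
    using order_decomp[OF assms(1)] unfolding m_def by blast
  then have qz: "poly q z \<noteq> 0" by (simp add: poly_eq_0_iff_dvd)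
  have sign: "leading_sign g z = sgn (poly q z)"
    unfolding leading_sign_def m_def[symmetric]
    by (subst g) (simp add: higher_pderiv_at_root sgn_mult)
  with qz show "leading_sign g z \<noteq> 0" by (simp add: sgn_zero_iff)
  have val: "poly g x = (x - z) ^ m * poly q x" for x
    by (simp add: g poly_power)
  have der: "(x - z) * poly (pderiv g) x = (x - z) ^ m * (m * poly q x + (x - z) * poly (pderiv q) x)" for x
  proof -
    obtain l where l: "m = Suc l" using m by (cases m) auto
    show ?thesis
      unfolding g l pderiv_mult pderiv_power_Suc
      by (simp add: poly_power pderiv_pCons algebra_simps)
  qed
  have lim: "((\<lambda>x. poly q x) \<longlongrightarrow> poly q z) (at z)"
    using poly_isCont isCont_def by blast
  have "eventually (\<lambda>x. 0 < poly q x * poly q z) (at z)"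
    using order_tendstoD(1)[OF tendsto_mult_right[OF lim, of "poly q z"], of 0] qz
    by (metis not_real_square_gt_zero)
  then have "eventually (\<lambda>x. sgn (poly q x) = sgn (poly q z)) (at z)"
    by eventually_elim (auto simp: sgn_if zero_less_mult_iff)
  then show "eventually (\<lambda>x. sgn (poly g x) = leading_sign g z * sgn (x - z) ^ order z g) (at z)"
    by eventually_elim (simp add: val sign m_def[symmetric] sgn_mult power_sgn)
  have "((\<lambda>x. (2 * m - 1) * (poly q x)\<^sup>2 + 2 * (x - z) * poly (pderiv q) x * poly q x) \<longlongrightarrow>
      (2 * m - 1) * (poly q z)\<^sup>2 + 2 * (z - z) * poly (pderiv q) z * poly q z) (at z)"
    by (intro tendsto_intros)
  moreover have "0 < (2 * m - 1) * (poly q z)\<^sup>2 + 2 * (z - z) * poly (pderiv q) z * poly q z"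
    using m qz by simp
  ultimately have "eventually (\<lambda>x. 0 < (2 * m - 1) * (poly q x)\<^sup>2
      + 2 * (x - z) * poly (pderiv q) x * poly q x) (at z)"
    by (rule order_tendstoD)
  then show "eventually (\<lambda>x. (poly g x)\<^sup>2 \<le> 2 * ((x - z) * poly (pderiv g) x * poly g x)) (at z)"
  proof eventually_elim
    case (elim x)
    have "2 * ((x - z) * poly (pderiv g) x * poly g x) - (poly g x)\<^sup>2
       = ((x - z) ^ m)\<^sup>2 * ((2 * m - 1) * (poly q x)\<^sup>2 + 2 * (x - z) * poly (pderiv q) x * poly q x)"
      unfolding der val using m by (simp add: algebra_simps power2_eq_square of_nat_diff)
    also have "\<dots> \<ge> 0" using elim by simp
    finally show ?case by simp
  qed
qed

text \<open>
  The left side is the sign of \<open>g\<close> immediately to the left of \<open>v\<close>, the right side its sign immediately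
  to the right of \<open>u\<close>.
\<close>

lemma leading_sign_adjacent_zeros:
  fixes g :: "real poly"
  assumes "g \<noteq> 0" "poly g u = 0" "poly g v = 0" "u < v"
    and no_zero: "\<And>x. \<lbrakk>u < x; x < v\<rbrakk> \<Longrightarrow> poly g x \<noteq> 0"
  shows "leading_sign g v * (-1) ^ order v g = leading_sign g u"
proof -
  define w where "w = (u + v) / 2"
  have w: "u < w" "w < v" using \<open>u < v\<close> unfolding w_def by auto
  have "\<forall>\<^sub>F x in at_right u. sgn (poly g x) = leading_sign g u * sgn (x - u) ^ order u g"
    using near_root(2)[of g u] assms eventually_at_split by blast
  moreover have "\<forall>\<^sub>F x in at_right u. u < x \<and> x < w"
    using w eventually_at_right_less eventually_at_right_field by (intro eventually_conj) auto
  ultimately have "\<forall>\<^sub>F x in at_right u. u < x \<and> x < w \<and> sgn (poly g x) = leading_sign g u"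
    by eventually_elim simp
  then obtain x where x: "u < x" "x < w" "sgn (poly g x) = leading_sign g u"
    using eventually_happens trivial_limit_at_right_real by blast
  have "\<forall>\<^sub>F y in at_left v. sgn (poly g y) = leading_sign g v * sgn (y - v) ^ order v g"
    using near_root(2)[of g v] assms eventually_at_split by blast
  moreover have "\<forall>\<^sub>F y in at_left v. w < y \<and> y < v"
    using w eventually_at_left_field[of _ v] by auto
  ultimately have "\<forall>\<^sub>F y in at_left v. w < y \<and> y < v \<and>
      sgn (poly g y) = leading_sign g v * (-1) ^ order v g"
    by eventually_elim simp
  then obtain y where y: "w < y" "y < v" "sgn (poly g y) = leading_sign g v * (-1) ^ order v g"
    using eventually_happens trivial_limit_at_left_real by blast
  have "sgn (poly g x) = sgn (poly g y)"
  proof (rule ccontr)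
    assume ne: "sgn (poly g x) \<noteq> sgn (poly g y)"
    have "poly g x \<noteq> 0" "poly g y \<noteq> 0" using no_zero x y w by auto
    with ne have "poly g x * poly g y < 0" by (auto simp: sgn_if mult_less_0_iff split: if_splits)
    then obtain t where "x < t" "t < y" "poly g t = 0"
      using poly_IVT[of x y g] x y by auto
    then show False using no_zero x y by auto
  qed
  with x y show ?thesis by simp
qed

lemma sgn_higher_deriv_at_zero:
  "sgn ((deriv ^^ order z g) (scaled_poly g a) z) = sgn a * leading_sign g z"
  unfolding higher_deriv_scaled_poly leading_sign_def by (simp add: scaled_poly_def sgn_mult)

section \<open>Half branches\<close>

definition band :: "real \<Rightarrow> real \<Rightarrow> real \<Rightarrow> real set" where
  "band c d \<rho> = {y. \<rho> * y \<in> {c..d}}"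

text \<open>With \<open>\<sigma> = 1\<close> this is the part to the right of \<open>z\<close>, with \<open>\<sigma> = -1\<close> the part to the left.\<close>

definition half_branch :: "(real \<Rightarrow> real) \<Rightarrow> real \<Rightarrow> real \<Rightarrow> real \<Rightarrow> real \<Rightarrow> real \<Rightarrow> real set" where
  "half_branch f \<epsilon> c d z \<sigma> = {x. \<sigma> * (x - z) \<in> {0..\<epsilon>} \<and> \<bar>f x\<bar> \<in> {c..d}}"

definition expanding_branch ::
    "(real \<Rightarrow> real) \<Rightarrow> (real \<Rightarrow> real) \<Rightarrow> real set \<Rightarrow> real set \<Rightarrow> bool" where
  "expanding_branch f f' H B \<longleftrightarrow> compact H \<and> f ` H = B \<and> (\<forall>x\<in>H. 2 \<le> \<bar>f' x\<bar>) \<and>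
     (\<forall>x\<in>H. \<forall>y\<in>H. 2 * \<bar>x - y\<bar> \<le> \<bar>f x - f y\<bar>)"

text \<open>
  The model case of a half branch at the zero \<open>0\<close>, to its right. Points \<open>t\<close> with \<open>A * \<psi> t \<le> d\<close> approach \<open>0\<close>
  as \<open>A\<close> grows, because \<open>\<psi>\<close> increases; and \<open>A * \<psi>' t \<ge> A * \<psi> t / (2 * t) \<ge> c / (2 * t)\<close> then
  makes the slope as large as desired.
\<close>

lemma steep_half_branch:
  fixes \<psi> \<psi>' :: "real \<Rightarrow> real"
  assumes deriv: "\<And>t. (\<psi> has_real_derivative \<psi>' t) (at t)"
    and zero: "\<psi> 0 = 0"
    and pos: "\<And>t. \<lbrakk>0 < t; t \<le> \<epsilon>\<rbrakk> \<Longrightarrow> 0 < \<psi> t"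
    and log_deriv: "\<And>t. \<lbrakk>0 < t; t \<le> \<epsilon>\<rbrakk> \<Longrightarrow> \<psi> t \<le> 2 * t * \<psi>' t"
    and "0 < \<epsilon>" "0 < c" "c \<le> d"
  shows "\<forall>\<^sub>F A in at_top. expanding_branch (\<lambda>t. A * \<psi> t) (\<lambda>t. A * \<psi>' t)
      {t \<in> {0..\<epsilon>}. A * \<psi> t \<in> {c..d}} {c..d}"
proof -
  \<comment> \<open>The slope \<open>c / (2 * t)\<close> is at least 2 exactly for \<open>t \<le> c / 4\<close>.\<close>
  define e where "e = min \<epsilon> (c / 4)"
  have e: "0 < e" "e \<le> \<epsilon>" "4 * e \<le> c" using assms unfolding e_def by auto
  have cont: "continuous_on S \<psi>" for S
    using deriv by (meson DERIV_isCont continuous_at_imp_continuous_on)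
  have mvt: "\<exists>\<xi>>t. \<xi> < u \<and> \<psi> u - \<psi> t = (u - t) * \<psi>' \<xi>" if "t < u" for t u
    using MVT2[OF that, of \<psi> \<psi>'] deriv by blast
  have deriv_pos: "0 < \<psi>' t" if "0 < t" "t \<le> \<epsilon>" for t
    using pos[OF that] log_deriv[OF that] that by (smt (verit) zero_less_mult_pos)
  have mono: "\<psi> t \<le> \<psi> u" if "0 \<le> t" "t \<le> u" "u \<le> \<epsilon>" for t u
  proof (cases "t = u")
    case False
    with that have "t < u" by simp
    then obtain \<xi> where "t < \<xi>" "\<xi> < u" "\<psi> u - \<psi> t = (u - t) * \<psi>' \<xi>"
      using mvt[OF \<open>t < u\<close>] by blast
    then show ?thesis using deriv_pos[of \<xi>] that
      by (smt (verit) mult_nonneg_nonneg)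
  qed simp
  have "\<forall>\<^sub>F A in at_top. d / \<psi> e < A \<and> 0 < A"
    by (intro eventually_conj eventually_gt_at_top)
  then show ?thesis
  proof eventually_elim
    case (elim A)
    define T where "T = {t \<in> {0..\<epsilon>}. A * \<psi> t \<in> {c..d}}"
    have large: "d < A * \<psi> e" using elim pos[OF e(1,2)] by (simp add: field_simps)
    have near: "0 < t" "t < e" if "t \<in> T" for t
    proof -
      show "0 < t" using that zero \<open>0 < c\<close> unfolding T_def by (cases "t = 0") auto
      show "t < e"
      proof (rule ccontr)
        assume "\<not> t < e"
        then have "A * \<psi> e \<le> A * \<psi> t" using mono[of e t] e elim that unfolding T_def by simp
        then show False using large that unfolding T_def by simp
      qed
    qed
    have steep: "2 \<le> A * \<psi>' t" if "t \<in> T" for t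
    proof -
      have "4 * t \<le> c" using near[OF that] e by simp
      also have "c \<le> A * \<psi> t" using that unfolding T_def by simp
      also have "\<dots> \<le> A * (2 * t * \<psi>' t)"
        using log_deriv[of t] near[OF that] e elim by (intro mult_left_mono) auto
      finally have "t * 2 \<le> t * (A * \<psi>' t)" by (simp add: algebra_simps)
      then show ?thesis using near[OF that] by simp
    qed
    \<comment> \<open>By monotonicity \<open>T\<close> contains the intermediate point of the mean value theorem.\<close>
    have expand: "2 * (u - t) \<le> A * \<psi> u - A * \<psi> t" if "t \<in> T" "u \<in> T" "t < u" for t u
    proof -
      obtain \<xi> where \<xi>: "t < \<xi>" "\<xi> < u" "\<psi> u - \<psi> t = (u - t) * \<psi>' \<xi>"
        using mvt[OF \<open>t < u\<close>] by blast
      have "A * \<psi> t \<le> A * \<psi> \<xi>" "A * \<psi> \<xi> \<le> A * \<psi> u"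
        using \<xi> that elim unfolding T_def by (auto intro!: mult_left_mono mono)
      then have "\<xi> \<in> T" using that \<xi> unfolding T_def by auto
      then have "(u - t) * 2 \<le> (u - t) * (A * \<psi>' \<xi>)"
        using steep that by (intro mult_left_mono) auto
      also have "\<dots> = A * \<psi> u - A * \<psi> t" using arg_cong[OF \<xi>(3), of "(*) A"] by (simp add: algebra_simps)
      finally show ?thesis by simp
    qed
    have "(\<lambda>t. A * \<psi> t) ` T = {c..d}"
    proof
      show "{c..d} \<subseteq> (\<lambda>t. A * \<psi> t) ` T"
      proof
        fix y assume y: "y \<in> {c..d}"
        have "\<exists>t\<ge>0. t \<le> e \<and> A * \<psi> t = y"
          using y large zero e \<open>0 < c\<close>
          by (intro IVT' continuous_intros cont) auto
        then show "y \<in> (\<lambda>t. A * \<psi> t) ` T" using y e unfolding T_def by force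
      qed
    qed (auto simp: T_def)
    moreover have "compact T"
    proof -
      have "T = {0..\<epsilon>} \<inter> (\<lambda>t. A * \<psi> t) -` {c..d}" unfolding T_def by auto
      then show ?thesis
        by (metis compact_Icc compact_Int_closed closed_atLeastAtMost closed_vimage
            continuous_on_mult_left cont)
    qed
    moreover have "2 * \<bar>t - u\<bar> \<le> \<bar>A * \<psi> t - A * \<psi> u\<bar>" if "t \<in> T" "u \<in> T" for t u
      using expand[of t u] expand[of u t] that by (cases t u rule: linorder_cases) auto
    ultimately show ?case
      unfolding expanding_branch_def T_def[symmetric] using steep by fastforce
  qed
qed

text \<open>
  Reflecting by \<open>\<sigma>\<close> and multiplying by the sign of \<open>g\<close> on the chosen side reduces every half branch to
  the model case, with \<open>A = |a|\<close>. The sign of \<open>a * g\<close> on that side decides which band is covered.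
\<close>

lemma eventually_expanding_branch:
  fixes g :: "real poly"
  assumes g: "g \<noteq> 0" "poly g z = 0" and \<sigma>: "\<sigma> \<in> {1, -1}" and cd: "0 < c" "c \<le> d"
  shows "\<forall>\<^sub>F \<epsilon> in at_right 0. \<forall>\<^sub>F a in at_infinity.
    expanding_branch (scaled_poly g a) (scaled_poly (pderiv g) a)
      (half_branch (scaled_poly g a) \<epsilon> c d z \<sigma>) (band c d (sgn a * leading_sign g z * \<sigma> ^ order z g))"
proof -
  define s where "s = leading_sign g z * \<sigma> ^ order z g"
  have ss: "s * s = 1" "\<sigma> * \<sigma> = 1" "\<bar>s\<bar> = 1" "\<bar>\<sigma>\<bar> = 1"
  proof -
    show "\<sigma> * \<sigma> = 1" "\<bar>\<sigma>\<bar> = 1" using \<sigma> by auto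
    have "\<bar>leading_sign g z\<bar> = 1"
      using near_root(1)[OF g] unfolding leading_sign_def by (auto simp: sgn_if)
    then show "\<bar>s\<bar> = 1" unfolding s_def abs_mult power_abs \<open>\<bar>\<sigma>\<bar> = 1\<close> by simp
    then show "s * s = 1" by (simp add: abs_if split: if_splits)
  qed
  define \<psi> where "\<psi> t = s * poly g (z + \<sigma> * t)" for t
  define \<psi>' where "\<psi>' t = s * \<sigma> * poly (pderiv g) (z + \<sigma> * t)" for t
  have deriv: "(\<psi> has_real_derivative \<psi>' t) (at t)" for t
    unfolding \<psi>_def \<psi>'_def
    by (auto intro!: derivative_eq_intros DERIV_chain2[OF poly_DERIV])
  obtain b where b: "0 < b"
    and loc: "\<And>x. \<lbrakk>x \<noteq> z; \<bar>x - z\<bar> < b\<rbrakk> \<Longrightarrow> sgn (poly g x) = leading_sign g z * sgn (x - z) ^ order z g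
      \<and> (poly g x)\<^sup>2 \<le> 2 * ((x - z) * poly (pderiv g) x * poly g x)"
    using eventually_conj[OF near_root(2,3)[OF g]]
    unfolding eventually_at dist_real_def by auto
  have half: "0 < \<psi> t" "\<psi> t \<le> 2 * t * \<psi>' t" if "0 < t" "t < b" for t
  proof -
    define x where "x = z + \<sigma> * t"
    have x: "x - z = \<sigma> * t" "x \<noteq> z" "\<bar>x - z\<bar> < b"
      using that \<sigma> unfolding x_def by auto
    have "sgn (x - z) = \<sigma>" using x(1) that \<sigma> by auto
    with loc[OF x(2,3)] have sgn: "sgn (poly g x) = s"
      and ineq: "(poly g x)\<^sup>2 \<le> 2 * (\<sigma> * t * poly (pderiv g) x * poly g x)"
      unfolding s_def x(1) by auto
    have "\<psi> t = \<bar>poly g x\<bar>" unfolding \<psi>_def x_def[symmetric] sgn[symmetric] by (simp add: abs_sgn mult.commute)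
    moreover have "poly g x \<noteq> 0" using sgn ss by auto
    ultimately show pos: "0 < \<psi> t" by simp
    have gx: "poly g x = s * \<psi> t" unfolding \<psi>_def x_def using ss by (simp add: mult.assoc[symmetric])
    have "\<psi> t * \<psi> t = (poly g x)\<^sup>2"
      unfolding gx using ss by (simp add: power2_eq_square algebra_simps)
    also note ineq
    also have "2 * (\<sigma> * t * poly (pderiv g) x * poly g x) = (2 * t * \<psi>' t) * \<psi> t"
      unfolding gx \<psi>'_def x_def[symmetric] by (simp only: mult_ac)
    finally show "\<psi> t \<le> 2 * t * \<psi>' t" using pos by simp
  qed
  have "\<forall>\<^sub>F \<epsilon> in at_right 0. 0 < \<epsilon> \<and> \<epsilon> < b"
    using eventually_at_right_less[of "0::real"] eventually_at_right_field b
    by (intro eventually_conj) auto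
  then show ?thesis
  proof eventually_elim
    case (elim \<epsilon>)
    have "\<forall>\<^sub>F A in at_top. expanding_branch (\<lambda>t. A * \<psi> t) (\<lambda>t. A * \<psi>' t)
        {t \<in> {0..\<epsilon>}. A * \<psi> t \<in> {c..d}} {c..d}"
    proof (rule steep_half_branch[OF deriv])
      show "\<psi> 0 = 0" using g unfolding \<psi>_def by simp
    qed (use half elim cd in auto)
    then have "\<forall>\<^sub>F a::real in at_infinity. expanding_branch (\<lambda>t. \<bar>a\<bar> * \<psi> t) (\<lambda>t. \<bar>a\<bar> * \<psi>' t)
        {t \<in> {0..\<epsilon>}. \<bar>a\<bar> * \<psi> t \<in> {c..d}} {c..d}"
      using filterlim_norm_at_top[where ?'a = real] unfolding real_norm_def
      by (rule eventually_compose_filterlim)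
    moreover have "\<forall>\<^sub>F a::real in at_infinity. a \<noteq> 0"
      by (rule eventually_not_equal_at_infinity)
    ultimately show ?case
    proof eventually_elim
      case (elim a)
      let ?T = "{t \<in> {0..\<epsilon>}. \<bar>a\<bar> * \<psi> t \<in> {c..d}}"
      let ?\<rho> = "sgn a * s"
      have rho: "?\<rho> * ?\<rho> = 1"
        using ss \<open>a \<noteq> 0\<close> by (auto simp: sgn_if)
      have f: "scaled_poly g a (z + \<sigma> * t) = ?\<rho> * (\<bar>a\<bar> * \<psi> t)" for t
      proof -
        have "?\<rho> * (\<bar>a\<bar> * \<psi> t) = (sgn a * \<bar>a\<bar>) * (s * s) * poly g (z + \<sigma> * t)"
          unfolding \<psi>_def by (simp only: mult_ac)
        then show ?thesis unfolding scaled_poly_def ss by (simp add: sgn_mult_abs)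
      qed
      have f': "\<bar>scaled_poly (pderiv g) a (z + \<sigma> * t)\<bar> = \<bar>\<bar>a\<bar> * \<psi>' t\<bar>" for t
        unfolding scaled_poly_def \<psi>'_def abs_mult ss by simp
      have arho: "\<bar>?\<rho>\<bar> = 1" using ss \<open>a \<noteq> 0\<close> by (simp add: abs_mult abs_sgn_eq)
      have nonneg: "0 \<le> \<psi> t" if "t \<in> {0..\<epsilon>}" for t
        using that half(1)[of t] \<open>0 < \<epsilon> \<and> \<epsilon> < b\<close> g by (cases "t = 0") (auto simp: \<psi>_def)
      have H: "half_branch (scaled_poly g a) \<epsilon> c d z \<sigma> = (\<lambda>t. z + \<sigma> * t) ` ?T" (is "?H = _")
      proof (intro equalityI subsetI)
        fix x assume x: "x \<in> ?H"
        define t where "t = \<sigma> * (x - z)"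
        have xt: "x = z + \<sigma> * t" unfolding t_def using ss(2) by (simp add: mult.assoc[symmetric])
        have t: "t \<in> {0..\<epsilon>}" using x unfolding half_branch_def t_def by auto
        have "\<bar>scaled_poly g a x\<bar> \<in> {c..d}" using x unfolding half_branch_def by blast
        then have "\<bar>?\<rho> * (\<bar>a\<bar> * \<psi> t)\<bar> \<in> {c..d}" unfolding xt f .
        then have "t \<in> ?T" unfolding abs_mult[of ?\<rho>] arho using t nonneg[OF t] by simp
        then show "x \<in> (\<lambda>t. z + \<sigma> * t) ` ?T" using xt by blast
      next
        fix x assume "x \<in> (\<lambda>t. z + \<sigma> * t) ` ?T"
        then obtain t where t: "t \<in> ?T" "x = z + \<sigma> * t" by blast
        have "\<sigma> * (x - z) = t" using t(2) ss(2) by (simp add: mult.assoc[symmetric])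
        moreover have "\<bar>scaled_poly g a x\<bar> \<in> {c..d}"
          unfolding t(2) f abs_mult[of ?\<rho>] arho using t(1) nonneg[of t] by simp
        ultimately show "x \<in> ?H" using t(1) unfolding half_branch_def by simp
      qed
      have B: "band c d ?\<rho> = (\<lambda>y. ?\<rho> * y) ` {c..d}"
      proof (intro equalityI subsetI)
        fix y assume "y \<in> band c d ?\<rho>"
        moreover have "y = ?\<rho> * (?\<rho> * y)" using rho by (simp add: mult.assoc[symmetric])
        ultimately show "y \<in> (\<lambda>y. ?\<rho> * y) ` {c..d}" unfolding band_def by blast
      next
        fix y assume "y \<in> (\<lambda>y. ?\<rho> * y) ` {c..d}"
        then obtain w where w: "w \<in> {c..d}" "y = ?\<rho> * w" by blast
        have "?\<rho> * y = w" unfolding w(2) mult.assoc[symmetric, of ?\<rho> ?\<rho>] rho by simp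
        then show "y \<in> band c d ?\<rho>" using w(1) unfolding band_def by simp
      qed
      note br = elim(1)[unfolded expanding_branch_def]
      have "compact ?H"
        unfolding H using br by (intro compact_continuous_image continuous_intros) auto
      moreover have "scaled_poly g a ` ?H = band c d ?\<rho>"
      proof -
        have "scaled_poly g a ` ?H = (\<lambda>t. ?\<rho> * (\<bar>a\<bar> * \<psi> t)) ` ?T"
          unfolding H image_image f ..
        also have "\<dots> = (\<lambda>y. ?\<rho> * y) ` ((\<lambda>t. \<bar>a\<bar> * \<psi> t) ` ?T)"
          unfolding image_image ..
        also have "(\<lambda>t. \<bar>a\<bar> * \<psi> t) ` ?T = {c..d}" using br by blast
        finally show ?thesis unfolding B .
      qed
      moreover have "2 * \<bar>x - y\<bar> \<le> \<bar>scaled_poly g a x - scaled_poly g a y\<bar>"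
        if xy: "x \<in> ?H" "y \<in> ?H" for x y
      proof -
        obtain t u where tu: "t \<in> ?T" "u \<in> ?T" "x = z + \<sigma> * t" "y = z + \<sigma> * u"
          using xy unfolding H by blast
        have "\<bar>x - y\<bar> = \<bar>t - u\<bar>"
          using ss(4) unfolding tu(3,4) by (simp add: abs_mult right_diff_distrib[symmetric])
        moreover have "\<bar>scaled_poly g a x - scaled_poly g a y\<bar> = \<bar>\<bar>a\<bar> * \<psi> t - \<bar>a\<bar> * \<psi> u\<bar>"
          unfolding tu(3,4) f right_diff_distrib[symmetric, of ?\<rho>] abs_mult[of ?\<rho>] arho by simp
        ultimately show ?thesis using br tu(1,2) by simp
      qed
      moreover have "\<forall>x\<in>?H. 2 \<le> \<bar>scaled_poly (pderiv g) a x\<bar>"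
        unfolding H using br f' by auto
      ultimately show ?case
        unfolding expanding_branch_def s_def mult.assoc by blast
    qed
  qed
qed

section \<open>The three covering patterns\<close>

lemma seq_space_eq_full_shift: "seq_space k = subshift_space k (\<lambda>i j. 1)"
  unfolding subshift_space_def by simp

definition has_hyperbolic_model :: "(real \<Rightarrow> real) \<Rightarrow> (nat \<Rightarrow> nat) set \<Rightarrow> bool" where
  "has_hyperbolic_model f S \<longleftrightarrow> (\<exists>L. hyperbolic_invariant_set f L \<and>
     topologically_conjugate (top_of_set L) f (seq_topology S) shift)"

lemma (in expanding_markov) has_hyperbolic_model: "has_hyperbolic_model f (subshift_space n A)"
  unfolding has_hyperbolic_model_def using hyperbolic conjugate by blast

lemma expanding_branch_nonempty: "expanding_branch f f' H B \<Longrightarrow> B \<noteq> {} \<Longrightarrow> H \<noteq> {}"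
  unfolding expanding_branch_def by auto

lemma disjoint_bands: "0 < c \<Longrightarrow> band c d \<rho> \<inter> band c d (-\<rho>) = {}"
  unfolding band_def by auto

lemma band_nonempty: "\<lbrakk>c \<le> d; \<rho> \<in> {1, -1}\<rbrakk> \<Longrightarrow> band c d \<rho> \<noteq> {}"
  unfolding band_def by (auto intro!: exI[of _ "\<rho> * c"])

locale two_band_map =
  fixes f f' :: "real \<Rightarrow> real" and c d :: real
  assumes has_deriv: "\<And>x. (f has_real_derivative f' x) (at x)"
    and cont_deriv: "continuous_on UNIV f'"
    and c: "0 < c" "c \<le> d"
begin

abbreviation expanding_onto :: "real set \<Rightarrow> real set \<Rightarrow> bool" where
  "expanding_onto \<equiv> expanding_branch f f'"

text \<open>
  Two points on branches with opposite target bands, whose images lie in a common band, are on the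
  same branch. So a pair of such branches may be merged into one symbol.
\<close>

lemma expand_on_union:
  assumes H: "expanding_onto H (band c d \<rho>)" and H': "expanding_onto H' (band c d (-\<rho>))"
    and \<rho>: "\<rho> \<in> {1, -1}" and \<tau>: "\<tau> \<in> {1, -1}"
    and xy: "x \<in> H \<union> H'" "y \<in> H \<union> H'" "f x \<in> band c d \<tau>" "f y \<in> band c d \<tau>"
  shows "2 * \<bar>x - y\<bar> \<le> \<bar>f x - f y\<bar>"
proof -
  have "f x \<notin> band c d \<rho> \<or> f y \<notin> band c d (-\<rho>)" "f x \<notin> band c d (-\<rho>) \<or> f y \<notin> band c d \<rho>"
    using disjoint_bands[OF c(1), of d \<tau>] \<rho> \<tau> xy(3,4) by auto
  then have "x \<in> H \<and> y \<in> H \<or> x \<in> H' \<and> y \<in> H'"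
    using H H' xy(1,2) unfolding expanding_branch_def by blast
  then show ?thesis using H H' unfolding expanding_branch_def by blast
qed

lemma horseshoe_same_zero:
  assumes H: "expanding_onto H1 (band c d \<rho>)" "expanding_onto H2 (band c d \<rho>)"
    and disj: "H1 \<inter> H2 = {}"
    and sub: "H1 \<subseteq> band c d \<rho>" "H2 \<subseteq> band c d \<rho>" and \<rho>: "\<rho> \<in> {1, -1}"
  shows "has_hyperbolic_model f (seq_space 2)"
proof -
  define J where "J i = (if i = 1 then H1 else H2)" for i :: nat
  have J: "expanding_onto (J i) (band c d \<rho>)" "J i \<subseteq> band c d \<rho>" for i
    using H sub unfolding J_def by auto
  interpret expanding_markov f f' 2 "\<lambda>i j. 1" J 2
  proof
    show "disjoint_family_on J {1..2}"
      unfolding disjoint_family_on_def J_def using disj by auto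
    show "J i \<noteq> {}" for i
      using expanding_branch_nonempty[OF J(1) band_nonempty[OF c(2) \<rho>]] .
    show "transition_matrix 2 (\<lambda>i j. 1)"
      unfolding transition_matrix_def by auto
  qed (use J has_deriv cont_deriv in \<open>auto simp: expanding_branch_def\<close>)
  show ?thesis using has_hyperbolic_model unfolding seq_space_eq_full_shift .
qed

text \<open>
  The zero in the positive band has the half branches \<open>H1\<close>, \<open>H2\<close>, the one in the negative band has \<open>H3\<close>, \<open>H4\<close>.
  Within each pair the half branches are listed by the band they cover, not by their side of the zero.
\<close>

lemma horseshoe_two_crossings:
  assumes H: "expanding_onto H1 (band c d \<rho>)" "expanding_onto H2 (band c d (-\<rho>))"
      "expanding_onto H3 (band c d \<rho>)" "expanding_onto H4 (band c d (-\<rho>))"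
    and sub: "H1 \<union> H2 \<subseteq> band c d 1" "H3 \<union> H4 \<subseteq> band c d (-1)" and \<rho>: "\<rho> \<in> {1, -1}"
  shows "has_hyperbolic_model f (seq_space 2)"
proof -
  define J where "J i = (if i = 1 then H1 \<union> H2 else H3 \<union> H4)" for i :: nat
  define \<tau> :: "nat \<Rightarrow> real" where "\<tau> i = (if i = 1 then 1 else -1)" for i
  have J: "J i \<subseteq> band c d (\<tau> i)" and \<tau>: "\<tau> i \<in> {1, -1}" for i
    using sub unfolding J_def \<tau>_def by auto
  have onto: "f ` J i = band c d \<rho> \<union> band c d (-\<rho>)" for i
    using H unfolding J_def expanding_branch_def by (auto simp: image_Un)
  interpret expanding_markov f f' 2 "\<lambda>i j. 1" J 2
  proof
    show "disjoint_family_on J {1..2}"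
      unfolding disjoint_family_on_def J_def using sub disjoint_bands[OF c(1), of d 1] by auto
    show "J i \<noteq> {}" for i
      using onto[of i] band_nonempty[OF c(2) \<rho>] by auto
    show "transition_matrix 2 (\<lambda>i j. 1)"
      unfolding transition_matrix_def by auto
    show "compact (J i)" for i
      using H unfolding J_def expanding_branch_def by auto
    show "J j \<subseteq> f ` J i" for i j
      unfolding onto using J[of j] \<tau>[of j] \<rho> by auto
    show "2 \<le> \<bar>f' x\<bar>" if "x \<in> J i" for i x
      using H that unfolding J_def expanding_branch_def by (auto split: if_splits)
    show "2 * \<bar>x - y\<bar> \<le> \<bar>f x - f y\<bar>" if "x \<in> J i" "y \<in> J i" "f x \<in> J j" "f y \<in> J j" for i j x y
    proof (cases "i = 1")
      case True
      then show ?thesis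
        using expand_on_union[OF H(1,2) \<rho> \<tau>[of j], of x y] that J[of j] unfolding J_def by auto
    next
      case False
      then show ?thesis
        using expand_on_union[OF H(3,4) \<rho> \<tau>[of j], of x y] that J[of j] unfolding J_def by auto
    qed
  qed (use has_deriv cont_deriv in auto)
  show ?thesis using has_hyperbolic_model unfolding seq_space_eq_full_shift .
qed

text \<open>
  \<open>H1\<close> and \<open>H2\<close> are the half branches at the zero where the sign is kept. It is the sign of the other zero, so
  both cover \<open>H3 \<union> H4\<close>, the piece of symbol 3, which in turn covers both bands: this is \<open>matrix_A\<close>.
\<close>

lemma horseshoe_fold_and_crossing:
  assumes H: "expanding_onto H1 (band c d (-\<rho>))" "expanding_onto H2 (band c d (-\<rho>))"
      "expanding_onto H3 (band c d \<rho>)" "expanding_onto H4 (band c d (-\<rho>))"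
    and disj: "H1 \<inter> H2 = {}"
    and sub: "H1 \<subseteq> band c d \<rho>" "H2 \<subseteq> band c d \<rho>" "H3 \<union> H4 \<subseteq> band c d (-\<rho>)"
    and \<rho>: "\<rho> \<in> {1, -1}"
  shows "has_hyperbolic_model f (subshift_space 3 matrix_A)"
proof -
  define J where "J i = (if i = 1 then H1 else if i = 2 then H2 else H3 \<union> H4)" for i :: nat
  have J3: "J i = H3 \<union> H4" if "i \<noteq> 1" "i \<noteq> 2" for i
    using that unfolding J_def by simp
  define \<tau> :: "nat \<Rightarrow> real" where "\<tau> i = (if i = 3 then -\<rho> else \<rho>)" for i
  have J: "J i \<subseteq> band c d (\<tau> i)" if "i \<in> {1..3}" for i
    using sub that unfolding J_def \<tau>_def atLeastAtMost_1_3 by auto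
  have \<tau>: "\<tau> i \<in> {1, -1}" for i using \<rho> unfolding \<tau>_def by auto
  have image: "f ` J i = (if i = 1 \<or> i = 2 then band c d (-\<rho>) else band c d \<rho> \<union> band c d (-\<rho>))" for i
    using H unfolding J_def expanding_branch_def by (auto simp: image_Un)
  have ne: "band c d (-\<rho>) \<noteq> {}" by (rule band_nonempty[OF c(2)]) (use \<rho> in auto)
  interpret expanding_markov f f' 3 matrix_A J 2
  proof
    show "disjoint_family_on J {1..3}"
      unfolding disjoint_family_on_def J_def atLeastAtMost_1_3
      using sub disj disjoint_bands[OF c(1), of d \<rho>] by auto
    show "J i \<noteq> {}" for i
      using image[of i] ne by (auto split: if_splits)
    show "compact (J i)" for i
      using H unfolding J_def expanding_branch_def by auto
    show "J j \<subseteq> f ` J i" if "i \<in> {1..3}" "j \<in> {1..3}" "matrix_A i j = 1" for i j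
    proof -
      have "\<tau> j = -\<rho> \<or> i = 3"
        using that unfolding atLeastAtMost_1_3 \<tau>_def matrix_A_def by auto
      then show ?thesis
        unfolding image using J[OF that(2)] \<rho> unfolding \<tau>_def by (auto split: if_splits)
    qed
    show "2 \<le> \<bar>f' x\<bar>" if "x \<in> J i" for i x
      using H that unfolding J_def expanding_branch_def by (auto split: if_splits)
    show "2 * \<bar>x - y\<bar> \<le> \<bar>f x - f y\<bar>"
      if "i \<in> {1..3}" "j \<in> {1..3}" "x \<in> J i" "y \<in> J i" "f x \<in> J j" "f y \<in> J j" for i j x y
    proof (cases "i = 1 \<or> i = 2")
      case True
      then show ?thesis
        using H that unfolding J_def expanding_branch_def by (auto split: if_splits)
    next
      case False
      then show ?thesis
        using expand_on_union[OF H(3,4) \<rho> \<tau>[of j], of x y] that J[of j] J3[of i] by auto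
    qed
  qed (use has_deriv cont_deriv transition_matrix_A in auto)
  show ?thesis by (rule has_hyperbolic_model)
qed

end

section \<open>Horseshoes of large multiples of a polynomial\<close>

theorem theorem4p1:
  fixes g :: "real poly" and \<alpha> :: "nat \<Rightarrow> real" and m :: "nat \<Rightarrow> nat" and r i0 :: nat
  assumes monic: "lead_coeff g = 1"
    and r: "r \<ge> 2"
    and increasing: "strict_mono_on {1..r} \<alpha>"
    and zeros: "\<alpha> ` {1..r} = {x. poly g x = 0}"
    and mult: "\<forall>i\<in>{1..r}. m i = order (\<alpha> i) g"
    and i0: "1 \<le> i0" "i0 < r"
    and signs: "\<alpha> i0 < 0" "0 < \<alpha> (i0 + 1)"
  shows "\<exists>N>0. \<forall>a::real. \<bar>a\<bar> > (N::real) \<longrightarrow>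
     (\<forall>k\<in>{2, 6}. parameter_case k g \<alpha> m i0 a \<longrightarrow>
        (\<exists>L. hyperbolic_invariant_set (scaled_poly g a) L \<and>
             topologically_conjugate (top_of_set L) (scaled_poly g a)
               (seq_topology (subshift_space 3 matrix_A)) shift)) \<and>
     (\<forall>k\<in>{1, 3, 4, 5, 7, 8}. parameter_case k g \<alpha> m i0 a \<longrightarrow>
        (\<exists>L. hyperbolic_invariant_set (scaled_poly g a) L \<and>
             topologically_conjugate (top_of_set L) (scaled_poly g a)
               (seq_topology (seq_space 2)) shift))"
proof -
  define u v where "u = \<alpha> i0" and "v = \<alpha> (i0 + 1)"
  have uv: "u < 0" "0 < v" using signs unfolding u_def v_def by auto
  have g: "g \<noteq> 0" using monic by auto
  have zero: "poly g u = 0" "poly g v = 0"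
    using zeros i0 unfolding u_def v_def by auto
  have no_zero: "poly g x \<noteq> 0" if "u < x" "x < v" for x
  proof
    assume "poly g x = 0"
    then obtain j where j: "j \<in> {1..r}" "x = \<alpha> j" using zeros by blast
    have less: "\<alpha> i < \<alpha> j \<longleftrightarrow> i < j" if "i \<in> {1..r}" "j \<in> {1..r}" for i j
      by (rule strict_mono_on_less[OF increasing that])
    show False
      using less[of i0 j] less[of j "i0 + 1"] that i0 j unfolding u_def v_def by auto
  qed
  \<comment> \<open>Any \<open>c\<close> and \<open>d\<close> would do for which both zeros are interior to their bands.\<close>
  define c d where "c = min (-u) v / 2" and "d = 2 * max (-u) v"
  have cd: "0 < c" "c \<le> d"
    using uv unfolding c_def d_def by (auto simp: min_def max_def)
  have inside: "c < \<bar>z\<bar>" "\<bar>z\<bar> < d" if "z \<in> {u, v}" for z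
    using uv that unfolding c_def d_def by (auto simp: min_def max_def)
  define onto where "onto a \<epsilon> z \<sigma> \<longleftrightarrow>
    expanding_branch (scaled_poly g a) (scaled_poly (pderiv g) a)
      (half_branch (scaled_poly g a) \<epsilon> c d z \<sigma>) (band c d (sgn a * leading_sign g z * \<sigma> ^ order z g))"
    for a \<epsilon> z \<sigma>
  have "\<forall>\<^sub>F \<epsilon> in at_right 0. \<forall>\<^sub>F a in at_infinity. onto a \<epsilon> z \<sigma>" if "z \<in> {u, v}" "\<sigma> \<in> {1, -1}" for z \<sigma>
    unfolding onto_def using that zero by (intro eventually_expanding_branch g cd) auto
  then have "\<forall>\<^sub>F \<epsilon> in at_right 0. \<forall>z\<in>{u, v}. \<forall>\<sigma>\<in>{1, -1}. \<forall>\<^sub>F a in at_infinity. onto a \<epsilon> z \<sigma>"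
    by (intro eventually_ball_finite ballI) auto
  moreover have "\<forall>\<^sub>F \<epsilon> in at_right 0. \<forall>z\<in>{u, v}. \<epsilon> < \<bar>z\<bar> - c \<and> \<epsilon> < d - \<bar>z\<bar>"
    using inside
    by (intro eventually_ball_finite ballI eventually_conj order_tendstoD(2)[OF tendsto_ident_at]) auto
  ultimately have "\<forall>\<^sub>F \<epsilon> in at_right 0. (\<forall>z\<in>{u, v}. \<forall>\<sigma>\<in>{1, -1}. \<forall>\<^sub>F a in at_infinity. onto a \<epsilon> z \<sigma>)
      \<and> (\<forall>z\<in>{u, v}. \<epsilon> < \<bar>z\<bar> - c \<and> \<epsilon> < d - \<bar>z\<bar>)"
    by (rule eventually_conj)
  then obtain \<epsilon> where
    onto: "\<And>z \<sigma>. \<lbrakk>z \<in> {u, v}; \<sigma> \<in> {1, -1}\<rbrakk> \<Longrightarrow> \<forall>\<^sub>F a in at_infinity. onto a \<epsilon> z \<sigma>"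
    and small: "\<And>z. z \<in> {u, v} \<Longrightarrow> \<epsilon> < \<bar>z\<bar> - c \<and> \<epsilon> < d - \<bar>z\<bar>"
    using eventually_happens'[OF trivial_limit_at_right_real] by blast
  have "\<forall>\<^sub>F a in at_infinity. \<forall>z\<in>{u, v}. \<forall>\<sigma>\<in>{1, -1}. onto a \<epsilon> z \<sigma>"
    using onto by (intro eventually_ball_finite ballI) auto
  then obtain N where N: "N > 0"
    "\<And>a z \<sigma>. \<lbrakk>N \<le> \<bar>a\<bar>; z \<in> {u, v}; \<sigma> \<in> {1, -1}\<rbrakk> \<Longrightarrow> onto a \<epsilon> z \<sigma>"
    unfolding eventually_at_infinity_pos real_norm_def by blast
  have claim: "(\<forall>k\<in>{2, 6}. parameter_case k g \<alpha> m i0 a \<longrightarrow>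
        has_hyperbolic_model (scaled_poly g a) (subshift_space 3 matrix_A)) \<and>
     (\<forall>k\<in>{1, 3, 4, 5, 7, 8}. parameter_case k g \<alpha> m i0 a \<longrightarrow>
        has_hyperbolic_model (scaled_poly g a) (seq_space 2))" if "\<bar>a\<bar> > N" for a
  proof -
    define H where "H z \<sigma> = half_branch (scaled_poly g a) \<epsilon> c d z \<sigma>" for z \<sigma>
    define p q where "p = (deriv ^^ m i0) (scaled_poly g a) u"
      and "q = (deriv ^^ m (i0 + 1)) (scaled_poly g a) v"
    have ord: "m i0 = order u g" "m (i0 + 1) = order v g"
      using mult i0 unfolding u_def v_def by auto
    have sgn: "sgn a * leading_sign g u = sgn p" "sgn a * leading_sign g v = sgn q"
      unfolding p_def q_def ord sgn_higher_deriv_at_zero by auto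
    have vL_sgn: "sgn a * leading_sign g v * (-1) ^ order v g = sgn p"
      using leading_sign_adjacent_zeros[OF g zero _ no_zero] uv sgn(1) by (simp add: mult.assoc)
    interpret two_band_map "scaled_poly g a" "scaled_poly (pderiv g) a" c d
    proof
      show "(scaled_poly g a has_real_derivative scaled_poly (pderiv g) a x) (at x)" for x
        unfolding scaled_poly_def by (auto intro!: derivative_eq_intros)
      show "continuous_on UNIV (scaled_poly (pderiv g) a)"
        unfolding scaled_poly_def by (intro continuous_intros)
    qed (use cd in auto)
    note onto = N(2)[OF less_imp_le[OF that], unfolded onto_def, folded H_def]
    have uR: "expanding_onto (H u 1) (band c d (sgn p))"
      using onto[of u 1] sgn by simp
    have uL: "expanding_onto (H u (-1)) (band c d (sgn p * (-1) ^ m i0))"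
      using onto[of u "-1"] sgn ord by simp
    have vR: "expanding_onto (H v 1) (band c d (sgn q))"
      using onto[of v 1] sgn by simp
    have vL: "expanding_onto (H v (-1)) (band c d (sgn p))"
      using onto[of v "-1"] vL_sgn by simp
    have Hu: "H u \<sigma> \<subseteq> band c d (-1)" and Hv: "H v \<sigma> \<subseteq> band c d 1" if "\<sigma> \<in> {1, -1}" for \<sigma>
      using that small[of u] small[of v] uv unfolding H_def half_branch_def band_def by auto
    have disj: "H z (-1) \<inter> H z 1 = {}" if "z \<in> {u, v}" for z
    proof -
      have "x = z" if "x \<in> H z (-1)" "x \<in> H z 1" for x
        using that unfolding H_def half_branch_def by auto
      moreover have "z \<notin> H z 1"
        using that zero cd unfolding H_def half_branch_def scaled_poly_def by auto
      ultimately show ?thesis by blast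
    qed
    \<comment> \<open>The position of a zero decides the band in which its half branches lie, the signs of \<open>p\<close> and \<open>q\<close>
      and the parity decide the bands which they cover; the patterns are matched on these signs.\<close>
    have c13: "has_hyperbolic_model (scaled_poly g a) (seq_space 2)" if "p > 0" "q > 0"
      using horseshoe_same_zero[of "H v (-1)" 1 "H v 1"] vL vR that Hv disj by simp
    have c2: "has_hyperbolic_model (scaled_poly g a) (subshift_space 3 matrix_A)"
      if "p > 0" "q < 0" "even (m i0)"
      using horseshoe_fold_and_crossing[of "H u (-1)" "-1" "H u 1" "H v 1" "H v (-1)"]
        uL uR vL vR that Hu Hv disj by simp
    have c4: "has_hyperbolic_model (scaled_poly g a) (seq_space 2)" if "p > 0" "q < 0" "odd (m i0)"
      using horseshoe_two_crossings[of "H v (-1)" 1 "H v 1" "H u 1" "H u (-1)"]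
        uL uR vL vR that Hu Hv by simp
    have c5: "has_hyperbolic_model (scaled_poly g a) (seq_space 2)" if "p < 0" "q > 0" "odd (m i0)"
      using horseshoe_two_crossings[of "H v 1" 1 "H v (-1)" "H u (-1)" "H u 1"]
        uL uR vL vR that Hu Hv by simp
    have c6: "has_hyperbolic_model (scaled_poly g a) (subshift_space 3 matrix_A)"
      if "p < 0" "q < 0" "odd (m i0)"
      using horseshoe_fold_and_crossing[of "H v (-1)" 1 "H v 1" "H u (-1)" "H u 1"]
        uL uR vL vR that Hu Hv disj by simp
    have c78: "has_hyperbolic_model (scaled_poly g a) (seq_space 2)" if "p < 0" "even (m i0)"
      using horseshoe_same_zero[of "H u (-1)" "-1" "H u 1"] uL uR that Hu disj by simp
    show ?thesis
      unfolding parameter_case_def Let_def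
      unfolding u_def[symmetric] v_def[symmetric] p_def[symmetric] q_def[symmetric]
      using c13 c2 c4 c5 c6 c78 by auto
  qed
  show ?thesis
    using N(1) claim unfolding has_hyperbolic_model_def by (intro exI[of _ N]) blast
qed

end
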